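(* Fix $k\ge1$, let $\mathbb O:=\mathbb N^k$, let $S\subseteq\mathbb O$, let $I=I(S)\subseteq\mathbb Q[f_1,\dots,f_k]$ be the vanishing ideal of $S$, and let $\mathbb Q[Z]:=\mathbb Q[f_1,\dots,f_k]/I$. Fix $\varphi\in\mathbb Q[f_1,\dots,f_k]$ and suppose $\dim\mathbb Q[Z]_{\le(\varphi,S)}<\infty$. For $\Delta\in\mathbb N$ put $D=D(\Delta,S):=\{0,1,\dots,\Delta\}^k\cap S_{\leqslant}$. Then there exists $\Delta\in\mathbb N$ such that, if the coset $\varphi+I$ is binomial-bad, then for every $D$-good function $\Psi:D\to\mathbb N$ there exists $\vec f\in S\cap D$ with $\Psi(\vec f)\neq\varphi(\vec f)$.
   Context: For $\vec a,\vec b\in\mathbb N^k$ write $\vec a\leqslant\vec b$ if $a_i\le b_i$ for all $i$. $S_{\leqslant}:=\{\vec f\in\mathbb N^k:\exists\vec g\in S,\ \vec g\leqslant\vec f\}$. The vanishing ideal is $I(S)=\{\psi\in\mathbb Q[f_1,\dots,f_k]:\psi(\vec g)=0\ \forall\vec g\in S\}$. Define $\mathbb Q[Z]_{\le(\varphi,S)}:=\{\psi+I\in\mathbb Q[Z]:\exists\alpha\in\mathbb Q\ \forall\vec g\in S:\ |\psi(\vec g)|\le\alpha|\varphi(\vec g)|\}$ (a linear subspace). For $\vec b\in\mathbb N^k$ let $\beta_{\vec b}(\vec x):=\prod_{i=1}^k\binom{x_i}{b_i}$, where $\binom{x}{i}=x(x-1)\cdots(x-i+1)/i!$. For a set $D\subseteq\mathbb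 N^k$ closed under $\leqslant$-downward closure, every function $D\to\mathbb Q$ has a unique expression $\sum_{\vec b\in D}c_{\vec b}\beta_{\vec b}$ on $D$; a function $\Psi:D\to\mathbb N$ is called $D$-good if all its coefficients $c_{\vec b}$ in this expansion are nonnegative integers. A polynomial is binomial-good if all coefficients in its (finite, unique) expansion in the basis $\{\beta_{\vec b}:\vec b\in\mathbb N^k\}$ of $\mathbb Q[f_1,\dots,f_k]$ are nonnegative integers; a coset $\varphi+I$ is binomial-good if it contains a binomial-good polynomial, and binomial-bad otherwise.
   Formalization: S_≤ is taken as the downward closure {f : ∃g∈S, f ≤ g}; with the printed g ≤ f, D need not be downward closed (k=1, S={1} gives D={1,…,Δ}), so "D-good" would be undefined. The set S∩D is unaffected. *)

theory Defs
  imports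
    "HOL-Algebra.Embedded_Algebras"
    "HOL-Algebra.QuotRing"
    "HOL-Decision_Procs.Algebra_Aux"
    "HOL-Library.Poly_Mapping"
begin

text \<open>
  The number \<open>k \<ge> 1\<close> of variables is the cardinality of a finite index type \<open>'k\<close>. Thus
  \<open>'k \<Rightarrow> nat\<close> is \<open>\<nat>\<^sup>k\<close>, its order \<open>\<le>\<close> is the componentwise one, and the polynomial ring
  \<open>\<rat>[f\<^sub>1,\<dots>,f\<^sub>k]\<close> consists of the finitely supported maps from exponent vectors to \<open>rat\<close>,
  with the (convolution) ring structure of \<open>Poly_Mapping\<close>.
\<close>

type_synonym 'k qpoly = "('k \<Rightarrow>\<^sub>0 nat) \<Rightarrow>\<^sub>0 rat"

definition Const :: "rat \<Rightarrow> 'k qpoly"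
  where "Const c = Poly_Mapping.single 0 c"

definition Var :: "'k \<Rightarrow> 'k qpoly"
  where "Var i = Poly_Mapping.single (Poly_Mapping.single i 1) 1"

definition peval :: "('k::finite) qpoly \<Rightarrow> ('k \<Rightarrow> nat) \<Rightarrow> rat"
  where "peval p x =
    (\<Sum>m\<in>Poly_Mapping.keys p.
       Poly_Mapping.lookup p m * (\<Prod>i\<in>UNIV. of_nat (x i) ^ Poly_Mapping.lookup m i))"

text \<open>
  The library record \<open>cring_class_ops\<close> presents the type-class ring \<open>'k qpoly\<close> with its whole
  type as carrier; it gives access to the quotient rings and dimensions of HOL-Algebra.
\<close>

abbreviation qpoly_ring :: "'k qpoly ring"
  where "qpoly_ring \<equiv> cring_class_ops"

definition vanishing_ideal :: "(('k::finite) \<Rightarrow> nat) set \<Rightarrow> 'k qpoly set"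
  where "vanishing_ideal S = {\<psi>. \<forall>g\<in>S. peval \<psi> g = 0}"

definition coordinate_ring :: "(('k::finite) \<Rightarrow> nat) set \<Rightarrow> 'k qpoly set ring"
  where "coordinate_ring S = qpoly_ring Quot vanishing_ideal S"

definition residue_class :: "(('k::finite) \<Rightarrow> nat) set \<Rightarrow> 'k qpoly \<Rightarrow> 'k qpoly set"
  where "residue_class S \<psi> = vanishing_ideal S +>\<^bsub>qpoly_ring\<^esub> \<psi>"

text \<open>
  The image of \<open>\<rat>\<close> in the coordinate ring. The \<open>\<rat>\<close>-vector space structure of the coordinate
  ring is multiplication by these scalars. (For empty \<open>S\<close> both are the zero ring.)
\<close>

definition scalars :: "(('k::finite) \<Rightarrow> nat) set \<Rightarrow> 'k qpoly set set"
  where "scalars S = residue_class S ` range Const"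

definition bounded_classes ::
    "('k::finite) qpoly \<Rightarrow> ('k \<Rightarrow> nat) set \<Rightarrow> 'k qpoly set set"
  where "bounded_classes \<phi> S =
    {residue_class S \<psi> | \<psi>. \<exists>\<alpha>::rat. \<forall>g\<in>S. \<bar>peval \<psi> g\<bar> \<le> \<alpha> * \<bar>peval \<phi> g\<bar>}"

definition binomial_poly :: "(('k::finite) \<Rightarrow> nat) \<Rightarrow> 'k qpoly"
  where "binomial_poly b =
    (\<Prod>i\<in>UNIV. Const (1 / fact (b i)) * (\<Prod>j<b i. Var i - of_nat j))"

definition binomial_good :: "('k::finite) qpoly \<Rightarrow> bool"
  where "binomial_good p \<longleftrightarrow>
    (\<exists>c. finite {b. c b \<noteq> 0} \<and> p = (\<Sum>b | c b \<noteq> 0. Const (c b) * binomial_poly b)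
         \<and> (\<forall>b. c b \<in> \<nat>))"

definition binomial_good_class :: "('k::finite) qpoly set \<Rightarrow> bool"
  where "binomial_good_class C \<longleftrightarrow> (\<exists>p\<in>C. binomial_good p)"

abbreviation binomial_bad_class :: "('k::finite) qpoly set \<Rightarrow> bool"
  where "binomial_bad_class C \<equiv> \<not> binomial_good_class C"

text \<open>
  \<open>F = \<Sum>\<^bsub>b\<in>D\<^esub> c\<^sub>b \<beta>\<^sub>b\<close> on \<open>D\<close>. As \<open>\<beta>\<^sub>b(x) = 0\<close> unless \<open>b \<le> x\<close> (see \<open>binomial_poly_eq_0\<close>), only
  the terms with \<open>b \<le> x\<close> are summed; this makes sense also for infinite \<open>D\<close>. Existence and
  uniqueness are \<open>binomial_expansion_exists\<close> and \<open>binomial_expansion_unique\<close> below.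
\<close>

definition binomial_expansion ::
    "(('k::finite) \<Rightarrow> nat) set \<Rightarrow> (('k \<Rightarrow> nat) \<Rightarrow> rat) \<Rightarrow> (('k \<Rightarrow> nat) \<Rightarrow> rat) \<Rightarrow> bool"
  where "binomial_expansion D F c \<longleftrightarrow>
    (\<forall>x\<in>D. F x = (\<Sum>b | b \<in> D \<and> b \<le> x. c b * peval (binomial_poly b) x))"

text \<open>A function \<open>D \<rightarrow> \<nat>\<close> is a total function whose values outside \<open>D\<close> are irrelevant.\<close>

definition D_good :: "(('k::finite) \<Rightarrow> nat) set \<Rightarrow> (('k \<Rightarrow> nat) \<Rightarrow> nat) \<Rightarrow> bool"
  where "D_good D \<Psi> \<longleftrightarrow>
    (\<exists>c. binomial_expansion D (\<lambda>x. of_nat (\<Psi> x)) c \<and> (\<forall>b\<in>D. c b \<in> \<nat>))"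

text \<open>
  \<open>S\<^sub>\<le>\<close> is the \<^emph>\<open>downward\<close> closure of \<open>S\<close>, so that \<open>D(\<Delta>, S)\<close> is downward closed, as the notion of
  a \<open>D\<close>-good function requires. (The formula \<open>{f. \<exists>g\<in>S. g \<le> f}\<close>, with the inequality
  reversed, does not give such a set. A function that is good for it agrees on \<open>S\<close>, within the box,
  with one that is good in the present sense: see \<open>D_good_upward\<close> at the end of this theory.
  Hence a statement that no good function agrees with \<open>\<phi>\<close> on \<open>S \<inter> D\<close> carries over.)
\<close>

definition down_closure :: "(('k::finite) \<Rightarrow> nat) set \<Rightarrow> ('k \<Rightarrow> nat) set"
  where "down_closure S = {f. \<exists>g\<in>S. f \<le> g}"

definition D_set :: "nat \<Rightarrow> (('k::finite) \<Rightarrow> nat) set \<Rightarrow> ('k \<Rightarrow> nat) set"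
  where "D_set \<Delta> S = {f. \<forall>i. f i \<le> \<Delta>} \<inter> down_closure S"


subsection \<open>Evaluation\<close>

lemma finite_below: "finite {b :: 'k::finite \<Rightarrow> nat. b \<le> x}"
proof -
  have "{b. b \<le> x} \<subseteq> Pi\<^sub>E UNIV (\<lambda>i. {..x i})"
    by (auto simp: le_fun_def)
  then show ?thesis
    by (rule finite_subset) (simp add: finite_PiE)
qed

lemma peval_superset:
  assumes "finite A" "Poly_Mapping.keys p \<subseteq> A"
  shows "peval p x =
    (\<Sum>m\<in>A. Poly_Mapping.lookup p m * (\<Prod>i\<in>UNIV. of_nat (x i) ^ Poly_Mapping.lookup m i))"
  unfolding peval_def using assms
  by (intro sum.mono_neutral_left) (auto simp: in_keys_iff)

lemma peval_0 [simp]: "peval 0 x = 0"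
  by (simp add: peval_def)

lemma peval_add: "peval (p + q) x = peval p x + peval q x"
proof -
  let ?A = "Poly_Mapping.keys p \<union> Poly_Mapping.keys q"
  have "Poly_Mapping.keys (p + q) \<subseteq> ?A" by (rule Poly_Mapping.keys_add)
  then show ?thesis
    by (simp add: peval_superset[of ?A] lookup_add distrib_right sum.distrib)
qed

lemma peval_single:
  "peval (Poly_Mapping.single m c) x = c * (\<Prod>i\<in>UNIV. of_nat (x i) ^ Poly_Mapping.lookup m i)"
  by (simp add: peval_superset[of "{m}"])

lemma peval_Const [simp]: "peval (Const c) x = c"
  by (simp add: Const_def peval_single)

lemma peval_Var [simp]: "peval (Var i) x = of_nat (x i)"
proof -
  have "(\<Prod>j\<in>UNIV. (of_nat (x j) :: rat) ^ Poly_Mapping.lookup (Poly_Mapping.single i 1) j)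
      = (\<Prod>j\<in>UNIV. if j = i then of_nat (x i) else 1)"
    by (intro prod.cong) (auto simp: lookup_single when_def)
  then show ?thesis
    by (simp add: Var_def peval_single)
qed

lemma peval_sum: "peval (\<Sum>a\<in>A. f a) x = (\<Sum>a\<in>A. peval (f a) x)"
  by (induction A rule: infinite_finite_induct) (auto simp: peval_add)

lemma qpoly_decomp: "p = (\<Sum>m\<in>Poly_Mapping.keys p. Poly_Mapping.single m (Poly_Mapping.lookup p m))"
  by (rule poly_mapping_eqI)
     (auto simp: lookup_sum lookup_single when_def in_keys_iff sum.delta' cong: if_cong)

lemma peval_mult: "peval (p * q) x = peval p x * peval q x"
proof -
  let ?s = "\<lambda>p m. Poly_Mapping.single m (Poly_Mapping.lookup p m)"
  have single: "peval (?s p m * ?s q n) x = peval (?s p m) x * peval (?s q n) x" for m n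
    by (simp add: mult_single peval_single lookup_add power_add prod.distrib)
  have "peval (p * q) x = peval ((\<Sum>m\<in>Poly_Mapping.keys p. ?s p m) * (\<Sum>n\<in>Poly_Mapping.keys q. ?s q n)) x"
    using qpoly_decomp[of p] qpoly_decomp[of q] by simp
  also have "\<dots> = peval (\<Sum>m\<in>Poly_Mapping.keys p. ?s p m) x * peval (\<Sum>n\<in>Poly_Mapping.keys q. ?s q n) x"
    by (simp add: sum_product peval_sum single)
  also have "\<dots> = peval p x * peval q x"
    using qpoly_decomp[of p] qpoly_decomp[of q] by simp
  finally show ?thesis .
qed

lemma peval_uminus: "peval (- p) x = - peval p x"
  using peval_add[of p "- p" x] by simp

lemma peval_diff: "peval (p - q) x = peval p x - peval q x"
  using peval_add[of p "- q" x] by (simp add: peval_uminus)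

lemma peval_1 [simp]: "peval 1 x = 1"
  using peval_Const[of 1 x] by (simp add: Const_def)

lemma peval_of_nat [simp]: "peval (of_nat n) x = of_nat n"
  by (induction n) (simp_all add: peval_add)

lemma peval_prod: "peval (\<Prod>a\<in>A. f a) x = (\<Prod>a\<in>A. peval (f a) x)"
  by (induction A rule: infinite_finite_induct) (auto simp: peval_mult)

lemma peval_binomial_poly:
  "peval (binomial_poly b) x = (\<Prod>i\<in>UNIV. of_nat (x i choose b i))"
  by (simp add: binomial_poly_def peval_prod peval_mult peval_diff binomial_gbinomial
      gbinomial_prod_rev atLeast0LessThan)

lemma binomial_poly_eq_0: "\<not> b \<le> x \<Longrightarrow> peval (binomial_poly b) x = 0"
  by (auto simp: peval_binomial_poly le_fun_def not_le prod_zero_iff)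

lemma binomial_poly_diag [simp]: "peval (binomial_poly b) b = 1"
  by (simp add: peval_binomial_poly)


subsection \<open>The vanishing ideal\<close>

lemma vanishing_ideal: "ideal (vanishing_ideal S) qpoly_ring"
proof (rule idealI)
  show "ring qpoly_ring"
    by (rule cring.axioms(1)[OF cring_class])
  show "subgroup (vanishing_ideal S) (add_monoid qpoly_ring)"
  proof (rule group.subgroupI)
    show "group (add_monoid qpoly_ring)"
      using cring.axioms(1)[OF cring_class] abelian_group.a_group ring.is_abelian_group by blast
    show "vanishing_ideal S \<noteq> {}"
      by (auto simp: vanishing_ideal_def intro: exI[of _ 0])
    fix a b :: "'a qpoly"
    assume "a \<in> vanishing_ideal S" "b \<in> vanishing_ideal S"
    then show "inv\<^bsub>add_monoid qpoly_ring\<^esub> a \<in> vanishing_ideal S"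
      and "a \<otimes>\<^bsub>add_monoid qpoly_ring\<^esub> b \<in> vanishing_ideal S"
      using uminus_class[of a] plus_class[of a b]
      by (simp_all add: vanishing_ideal_def a_inv_def peval_uminus peval_add)
  qed (simp add: cring_class_ops_def)
qed (auto simp: vanishing_ideal_def times_class peval_mult)

lemma residue_class_altdef: "residue_class S \<psi> = {p. \<forall>g\<in>S. peval p g = peval \<psi> g}"
proof -
  have "p \<in> residue_class S \<psi>" if "\<forall>g\<in>S. peval p g = peval \<psi> g" for p
    using that unfolding residue_class_def a_r_coset_def' vanishing_ideal_def
    by (auto simp: plus_class peval_diff intro!: exI[of _ "p - \<psi>"])
  then show ?thesis
    by (auto simp: residue_class_def a_r_coset_def' vanishing_ideal_def plus_class peval_add)
qed

lemma residue_class_eq_iff: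
  "residue_class S \<psi> = residue_class S \<chi> \<longleftrightarrow> (\<forall>g\<in>S. peval \<psi> g = peval \<chi> g)"
  by (auto simp: residue_class_altdef)

lemma coordinate_ring_cring: "cring (coordinate_ring S)"
  unfolding coordinate_ring_def by (rule ideal.quotient_is_cring[OF vanishing_ideal cring_class])


subsection \<open>Binomial expansions\<close>

lemma sum_less:
  fixes b x :: "'k::finite \<Rightarrow> nat"
  assumes "b < x"
  shows "(\<Sum>i\<in>UNIV. b i) < (\<Sum>i\<in>UNIV. x i)"
proof (rule sum_strict_mono_ex1)
  show "\<forall>i\<in>UNIV. b i \<le> x i"
    using less_imp_le[OF assms] by (simp add: le_fun_def)
  have "\<not> x \<le> b"
    using assms by (auto dest: leD)
  then show "\<exists>i\<in>UNIV. b i < x i"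
    by (simp add: le_fun_def not_le)
qed simp

lemma binomial_expansion_exists: "\<exists>c. binomial_expansion D F c"
proof -
  define r where "r = measure (\<lambda>x :: 'a \<Rightarrow> nat. \<Sum>i\<in>UNIV. x i)"
  have less: "(b, x) \<in> r" if "b < x" for b x
    using sum_less[OF that] by (simp add: r_def)
  define G where "G = (\<lambda>c x. F x - (\<Sum>b | b \<in> D \<and> b < x. c b * peval (binomial_poly b) x))"
  define c where "c = wfrec r G"
  have c: "c x = G c x" for x
  proof -
    have "c x = G (cut c r x) x"
      unfolding c_def by (rule wfrec) (simp add: r_def)
    also have "\<dots> = G c x"
      unfolding G_def by (intro arg_cong2[where f = minus] sum.cong) (auto simp: cut_apply less)
    finally show ?thesis .
  qed
  have "binomial_expansion D F c"
    unfolding binomial_expansion_def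
  proof
    fix x assume "x \<in> D"
    then have *: "{b. b \<in> D \<and> b \<le> x} = insert x {b. b \<in> D \<and> b < x}"
      by auto
    have "finite {b. b \<in> D \<and> b < x}"
      by (rule finite_subset[OF _ finite_below[of x]]) auto
    then show "F x = (\<Sum>b | b \<in> D \<and> b \<le> x. c b * peval (binomial_poly b) x)"
      using c[of x] by (simp add: * G_def)
  qed
  then show ?thesis by (intro exI[where x = c])
qed

lemma binomial_expansion_unique:
  assumes "binomial_expansion D F c" "binomial_expansion D F d" "x \<in> D"
  shows "c x = d x"
  using \<open>x \<in> D\<close>
proof (induction "\<Sum>i\<in>UNIV. x i" arbitrary: x rule: less_induct)
  case less
  have *: "{b. b \<in> D \<and> b \<le> x} = insert x {b. b \<in> D \<and> b < x}"
    using less.prems by auto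
  have fin: "finite {b. b \<in> D \<and> b < x}"
    by (rule finite_subset[OF _ finite_below[of x]]) auto
  have "c b = d b" if "b \<in> D" "b < x" for b
  proof (rule less.hyps)
    show "(\<Sum>i\<in>UNIV. b i) < (\<Sum>i\<in>UNIV. x i)"
      by (rule sum_less) fact
  qed fact
  then have "(\<Sum>b | b \<in> D \<and> b < x. c b * peval (binomial_poly b) x)
      = (\<Sum>b | b \<in> D \<and> b < x. d b * peval (binomial_poly b) x)"
    by (intro sum.cong) auto
  moreover have "F x = c x + (\<Sum>b | b \<in> D \<and> b < x. c b * peval (binomial_poly b) x)"
    using assms(1) less.prems fin by (simp add: binomial_expansion_def *)
  moreover have "F x = d x + (\<Sum>b | b \<in> D \<and> b < x. d b * peval (binomial_poly b) x)"
    using assms(2) less.prems fin by (simp add: binomial_expansion_def *)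
  ultimately show ?case by simp
qed

lemma D_good_upward:
  assumes "D_good ({f. \<forall>i. f i \<le> \<Delta>} \<inter> {f. \<exists>g\<in>S. g \<le> f}) \<Psi>"
  obtains \<Psi>' where "D_good (D_set \<Delta> S) \<Psi>'"
    and "\<And>f. f \<in> S \<Longrightarrow> (\<forall>i. f i \<le> \<Delta>) \<Longrightarrow> \<Psi>' f = \<Psi> f"
proof -
  define U where "U = {f. \<forall>i. f i \<le> \<Delta>} \<inter> {f. \<exists>g\<in>S. g \<le> f}"
  define D where "D = D_set \<Delta> S"
  obtain c where c: "binomial_expansion U (\<lambda>x. of_nat (\<Psi> x)) c" "\<forall>b\<in>U. c b \<in> \<nat>"
    using assms by (auto simp: D_good_def U_def)
  define d where "d = (\<lambda>b. if b \<in> U then c b else 0)"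
  define V where "V = (\<lambda>x. \<Sum>b | b \<in> D \<and> b \<le> x. d b * peval (binomial_poly b) x)"
  have d_Nats: "d b \<in> \<nat>" for b
    using c(2) by (simp add: d_def)
  have "V x \<in> \<nat>" for x
  proof -
    have "(\<Sum>b\<in>B. d b * peval (binomial_poly b) x) \<in> \<nat>" for B
      unfolding peval_binomial_poly of_nat_prod[symmetric]
      by (induction B rule: infinite_finite_induct) (simp_all add: d_Nats del: of_nat_prod)
    then show ?thesis by (simp add: V_def)
  qed
  then have "\<forall>x. \<exists>n. V x = of_nat n"
    by (auto simp: Nats_def)
  then obtain \<Psi>' where \<Psi>': "\<And>x. V x = of_nat (\<Psi>' x)"
    by (auto dest!: choice)
  have "D_good D \<Psi>'"
    unfolding D_good_def binomial_expansion_def \<Psi>'[symmetric] using d_Nats by (auto simp: V_def)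
  moreover have "\<Psi>' f = \<Psi> f" if f: "f \<in> S" "\<forall>i. f i \<le> \<Delta>" for f
  proof -
    have below: "b \<in> D" if "b \<le> f" for b
    proof -
      have "b i \<le> \<Delta>" for i
        using le_funD[OF that, of i] f(2) order_trans by blast
      then show ?thesis
        using that f(1) by (auto simp: D_def D_set_def down_closure_def)
    qed
    have "f \<in> U" using f by (auto simp: U_def)
    then have "of_nat (\<Psi> f) = (\<Sum>b | b \<in> U \<and> b \<le> f. c b * peval (binomial_poly b) f)"
      using c(1) by (simp add: binomial_expansion_def)
    also have "\<dots> = V f"
      unfolding V_def
    proof (rule sum.mono_neutral_cong_left)
      show "finite {b. b \<in> D \<and> b \<le> f}"
        by (rule finite_subset[OF _ finite_below[of f]]) auto
    qed (use below in \<open>auto simp: d_def\<close>)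
    finally show ?thesis by (simp add: \<Psi>')
  qed
  ultimately show ?thesis
    using that by (auto simp: D_def)
qed

end

theory Submission
  imports Defs
begin

text \<open>
  A finite-dimensional space of functions on \<open>S\<close> is determined by the values at a finite set
  \<open>T \<subseteq> S\<close>; apply this to the functions bounded by \<open>\<phi>\<close>. Let \<open>B\<close> be the finite downward closure of
  \<open>T\<close>. Suppose that for every \<open>\<Delta>\<close> some good function agrees with \<open>\<phi>\<close> on the box of size \<open>\<Delta>\<close>. Its
  coefficients on \<open>B\<close> are bounded by the values of \<open>\<phi>\<close> on \<open>T\<close>, so that for infinitely many \<open>\<Delta>\<close> they
  are the same numbers \<open>c\<^sub>b\<close>. Put \<open>p = \<Sum>\<^bsub>b\<in>B\<^esub> c\<^sub>b \<beta>\<^sub>b\<close>. Then \<open>0 \<le> p \<le> \<phi>\<close> on \<open>S\<close>, as the omitted terms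
  are nonnegative, and \<open>p = \<phi>\<close> on \<open>T\<close>, where no term is omitted. Hence \<open>\<phi> - p\<close> is bounded by \<open>\<phi>\<close>
  and vanishes on \<open>T\<close>, so it vanishes on \<open>S\<close>, and \<open>p\<close> witnesses that the class of \<open>\<phi>\<close> is
  binomial-good.
\<close>

section \<open>Finite sets of points that determine functions\<close>

text \<open>Induction on \<open>n\<close>. If \<open>T\<close> no longer suffices for n + 1
  functions, some combination \<open>c\<close> vanishes on \<open>T\<close> but not at a point
  \<open>s\<close> of \<open>S\<close>. Every combination vanishing on \<open>T\<close> is then a
  multiple of \<open>c\<close> on \<open>S\<close>, so adding \<open>s\<close> to \<open>T\<close>
  is enough.\<close>

lemma finite_determining_set:
  fixes f :: "nat \<Rightarrow> 'a \<Rightarrow> 'b::field"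
  shows "\<exists>T\<subseteq>S. finite T \<and>
    (\<forall>c. (\<forall>t\<in>T. (\<Sum>i<n. c i * f i t) = 0) \<longrightarrow> (\<forall>s\<in>S. (\<Sum>i<n. c i * f i s) = 0))"
proof (induction n)
  case 0
  show ?case by (auto intro!: exI[of _ "{}"])
next
  case (Suc n)
  then obtain T where T: "T \<subseteq> S" "finite T"
    and det: "\<And>c s. \<forall>t\<in>T. (\<Sum>i<n. c i * f i t) = 0 \<Longrightarrow> s \<in> S \<Longrightarrow> (\<Sum>i<n. c i * f i s) = 0"
    by meson
  show ?case
  proof (cases "\<exists>c. (\<forall>t\<in>T. (\<Sum>i<Suc n. c i * f i t) = 0) \<and> (\<exists>s\<in>S. (\<Sum>i<Suc n. c i * f i s) \<noteq> 0)")
    case False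
    then show ?thesis using T by blast
  next
    case True
    then obtain c s where c: "\<And>t. t \<in> T \<Longrightarrow> (\<Sum>i<Suc n. c i * f i t) = 0"
      and s: "s \<in> S" "(\<Sum>i<Suc n. c i * f i s) \<noteq> 0" by blast
    \<comment> \<open>Otherwise \<open>c\<close> would involve only the first \<open>n\<close>
      functions and vanish on all of \<open>S\<close>, in particular at \<open>s\<close>.\<close>
    have cn: "c n \<noteq> 0"
      using c s det[of c s] by auto
    have "(\<Sum>i<Suc n. d i * f i x) = 0"
      if d: "\<forall>t\<in>insert s T. (\<Sum>i<Suc n. d i * f i t) = 0" and x: "x \<in> S" for d x
    proof -
      \<comment> \<open>This ratio cancels the coefficient of index \<open>n\<close> in
        \<open>e\<close>, so that the induction hypothesis applies to \<open>e\<close>.\<close>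
      define r where "r = d n / c n"
      define e where "e i = d i - r * c i" for i
      have e: "(\<Sum>i<n. e i * f i y) = (\<Sum>i<Suc n. d i * f i y) - r * (\<Sum>i<Suc n. c i * f i y)" for y
      proof -
        have "e n = 0" using cn by (simp add: e_def r_def)
        then have "(\<Sum>i<n. e i * f i y) = (\<Sum>i<Suc n. e i * f i y)" by simp
        also have "\<dots> = (\<Sum>i<Suc n. d i * f i y) - r * (\<Sum>i<Suc n. c i * f i y)"
          unfolding sum_distrib_left sum_subtractf[symmetric]
          by (intro sum.cong) (auto simp: e_def algebra_simps)
        finally show ?thesis .
      qed
      have "\<forall>t\<in>T. (\<Sum>i<n. e i * f i t) = 0"
        unfolding e using c d by simp
      then have e0: "(\<Sum>i<n. e i * f i y) = 0" if "y \<in> S" for y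
        using det that by blast
      \<comment> \<open>At \<open>s\<close> the combinations \<open>d\<close> and \<open>e\<close>
        vanish, whereas \<open>c\<close> does not.\<close>
      have "r = 0"
        using e[of s] e0[of s] s d by simp
      then show ?thesis
        using e[of x] e0[OF x] by simp
    qed
    then show ?thesis
      using T s by (intro exI[of _ "insert s T"]) blast
  qed
qed

section \<open>The coordinate ring through representatives\<close>

lemma residue_class_add:
  "residue_class S \<psi> \<oplus>\<^bsub>coordinate_ring S\<^esub> residue_class S \<chi> = residue_class S (\<psi> + \<chi>)"
proof -
  interpret ideal "vanishing_ideal S" qpoly_ring by (rule vanishing_ideal)
  show ?thesis
    using a_rcos_sum[of \<psi> \<chi>]
    by (simp add: coordinate_ring_def residue_class_def FactRing_def carrier_class plus_class)
qed

lemma residue_class_mult: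
  "residue_class S \<psi> \<otimes>\<^bsub>coordinate_ring S\<^esub> residue_class S \<chi> = residue_class S (\<psi> * \<chi>)"
proof -
  interpret ideal "vanishing_ideal S" qpoly_ring by (rule vanishing_ideal)
  show ?thesis
    using rcoset_mult_add[of \<psi> \<chi>]
    by (simp add: coordinate_ring_def residue_class_def FactRing_def carrier_class times_class)
qed

lemma zero_coordinate_ring: "\<zero>\<^bsub>coordinate_ring S\<^esub> = residue_class S 0"
  by (simp add: coordinate_ring_def FactRing_def residue_class_altdef vanishing_ideal_def)

lemma carrier_coordinate_ring: "carrier (coordinate_ring S) = range (residue_class S)"
  by (auto simp: coordinate_ring_def FactRing_def A_RCOSETS_def' residue_class_def carrier_class)

text \<open>Translates the algebraic dimension into functions on \<open>S\<close>: each
  \<open>line_extension\<close> that builds up \<open>E\<close> contributes a representative of its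
  vector to the spanning family \<open>u\<close>.\<close>

lemma dimension_coordinate_ring_spanning:
  fixes S :: "('k::finite \<Rightarrow> nat) set"
  assumes "ring.dimension (coordinate_ring S) n (scalars S) E"
  shows "\<exists>u. \<forall>e\<in>E. \<exists>\<psi> c. e = residue_class S \<psi> \<and>
    (\<forall>g\<in>S. peval \<psi> g = (\<Sum>i<n. c i * peval (u i) g))"
proof -
  interpret R: ring "coordinate_ring S"
    by (rule cring.axioms(1)[OF coordinate_ring_cring])
  show ?thesis
    using assms
  proof (induction n "scalars S" E rule: R.dimension.induct)
    case zero_dim
    have "e = residue_class S 0 \<and> (\<forall>g\<in>S. peval 0 g = (\<Sum>i<0. 0 * peval 0 g))"
      if "e \<in> {\<zero>\<^bsub>coordinate_ring S\<^esub>}" for e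
      using that by (simp add: zero_coordinate_ring)
    then show ?case
      by (intro exI[where x = "\<lambda>_. 0"] ballI exI[where x = "0 :: 'k qpoly"])
  next
    case (Suc_dim v E n)
    from Suc_dim.hyps(4) obtain u
    where u: "\<forall>e\<in>E. \<exists>\<psi> c. e = residue_class S \<psi> \<and>
        (\<forall>g\<in>S. peval \<psi> g = (\<Sum>i<n. c i * peval (u i) g))" ..
    obtain \<chi> where \<chi>: "v = residue_class S \<chi>"
      using Suc_dim.hyps(1) by (auto simp: carrier_coordinate_ring)
    have "\<exists>\<psi> c. e = residue_class S \<psi> \<and>
        (\<forall>g\<in>S. peval \<psi> g = (\<Sum>i<Suc n. c i * peval ((u(n := \<chi>)) i) g))"
      if mem: "e \<in> R.line_extension (scalars S) v E" for e
    proof -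
      obtain k e' where e': "e' \<in> E"
        and e: "e = residue_class S (Const k) \<otimes>\<^bsub>coordinate_ring S\<^esub> v \<oplus>\<^bsub>coordinate_ring S\<^esub> e'"
        using mem unfolding R.line_extension_mem_iff scalars_def by blast
      obtain \<psi> c where \<psi>: "e' = residue_class S \<psi>"
        "\<And>g. g \<in> S \<Longrightarrow> peval \<psi> g = (\<Sum>i<n. c i * peval (u i) g)"
        using bspec[OF u e'] by blast
      have "e = residue_class S (Const k * \<chi> + \<psi>)"
        by (simp add: e \<psi>(1) \<chi> residue_class_add residue_class_mult)
      moreover have "peval (Const k * \<chi> + \<psi>) g
          = (\<Sum>i<Suc n. (c(n := k)) i * peval ((u(n := \<chi>)) i) g)" if "g \<in> S" for g
        using \<psi>(2)[OF that] by (simp add: peval_add peval_mult)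
      ultimately show ?thesis by blast
    qed
    then show ?case by (intro exI[where x = "u(n := \<chi>)"] ballI)
  qed
qed

lemma finite_dimension_determining_set:
  fixes S :: "('k::finite \<Rightarrow> nat) set"
  assumes "ring.finite_dimension (coordinate_ring S) (scalars S) E"
  obtains T where "T \<subseteq> S" "finite T"
    "\<And>\<psi> g. residue_class S \<psi> \<in> E \<Longrightarrow> \<forall>t\<in>T. peval \<psi> t = 0 \<Longrightarrow> g \<in> S \<Longrightarrow> peval \<psi> g = 0"
proof -
  interpret R: ring "coordinate_ring S"
    by (rule cring.axioms(1)[OF coordinate_ring_cring])
  obtain n where "R.dimension n (scalars S) E"
    using assms by (auto simp: R.finite_dimension_def)
  from dimension_coordinate_ring_spanning[OF this] obtain u
    where u: "\<forall>e\<in>E. \<exists>\<psi> c. e = residue_class S \<psi> \<and>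
      (\<forall>g\<in>S. peval \<psi> g = (\<Sum>i<n. c i * peval (u i) g))" ..
  obtain T where T: "T \<subseteq> S" "finite T"
    and det: "\<And>c g. \<forall>t\<in>T. (\<Sum>i<n. c i * peval (u i) t) = 0 \<Longrightarrow> g \<in> S
      \<Longrightarrow> (\<Sum>i<n. c i * peval (u i) g) = 0"
    using finite_determining_set[of S "\<lambda>i. peval (u i)" n] by meson
  show ?thesis
  proof (rule that[OF T])
    fix \<psi> g
    assume \<psi>: "residue_class S \<psi> \<in> E" "\<forall>t\<in>T. peval \<psi> t = 0" and g: "g \<in> S"
    obtain \<psi>' c where "residue_class S \<psi> = residue_class S \<psi>'"
      "\<forall>g\<in>S. peval \<psi>' g = (\<Sum>i<n. c i * peval (u i) g)"
      using bspec[OF u \<psi>(1)] by blast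
    then have c: "\<forall>g\<in>S. peval \<psi> g = (\<Sum>i<n. c i * peval (u i) g)"
      by (simp add: residue_class_eq_iff)
    have "\<forall>t\<in>T. (\<Sum>i<n. c i * peval (u i) t) = 0"
      using c \<psi>(2) T(1) by (metis subsetD)
    then show "peval \<psi> g = 0"
      using det[OF _ g] c g by simp
  qed
qed

section \<open>Coefficients of good functions\<close>

text \<open>All points below such an \<open>f\<close> lie in \<open>D_set \<Delta> S\<close>. The
  range of summation therefore depends on \<open>f\<close> alone, which makes coefficients for
  different \<Delta> comparable.\<close>

lemma D_good_nat_coefficients:
  assumes "D_good (D_set \<Delta> S) \<Psi>"
  obtains c :: "('k::finite \<Rightarrow> nat) \<Rightarrow> nat" where
    "\<And>f. f \<in> S \<Longrightarrow> (\<And>i. f i \<le> \<Delta>) \<Longrightarrow>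
      of_nat (\<Psi> f) = (\<Sum>b\<in>{..f}. of_nat (c b) * peval (binomial_poly b) f)"
proof -
  obtain c where c: "binomial_expansion (D_set \<Delta> S) (\<lambda>x. of_nat (\<Psi> x)) c"
    "\<forall>b\<in>D_set \<Delta> S. c b \<in> \<nat>"
    using assms by (auto simp: D_good_def)
  then have "\<forall>b. \<exists>n. b \<in> D_set \<Delta> S \<longrightarrow> c b = of_nat n"
    by (auto simp: Nats_def)
  then obtain n where n: "\<And>b. b \<in> D_set \<Delta> S \<Longrightarrow> c b = of_nat (n b)"
    by metis
  show ?thesis
  proof (rule that)
    fix f assume f: "f \<in> S" "\<And>i. f i \<le> \<Delta>"
    have below: "b \<in> D_set \<Delta> S" if "b \<le> f" for b
      using that f by (auto simp: D_set_def down_closure_def le_fun_def intro: order_trans)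
    then have "{b. b \<in> D_set \<Delta> S \<and> b \<le> f} = {..f}" by auto
    moreover have "of_nat (\<Psi> f) = (\<Sum>b | b \<in> D_set \<Delta> S \<and> b \<le> f. c b * peval (binomial_poly b) f)"
      using c(1) below[of f] by (simp add: binomial_expansion_def)
    ultimately show "of_nat (\<Psi> f) = (\<Sum>b\<in>{..f}. of_nat (n b) * peval (binomial_poly b) f)"
      by (simp add: n below)
  qed
qed

lemma peval_binomial_poly_nonneg: "0 \<le> peval (binomial_poly b) x"
  by (simp add: peval_binomial_poly prod_nonneg)

text \<open>The value is a positive integer, as no factor vanishes. Hence a coefficient is at most
  the value of its term.\<close>

lemma peval_binomial_poly_ge_1:
  assumes "b \<le> x"
  shows "1 \<le> peval (binomial_poly b) x"
proof -
  have "0 < (\<Prod>i\<in>UNIV. x i choose b i)"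
    using assms by (auto simp: le_fun_def intro!: prod_pos)
  then show ?thesis
    unfolding peval_binomial_poly of_nat_prod[symmetric] by linarith
qed

section \<open>From good functions on all boxes to a good polynomial\<close>

theorem theorem5p11:
  fixes S :: "('k::finite \<Rightarrow> nat) set" and \<phi> :: "'k qpoly"
  assumes "ring.finite_dimension (coordinate_ring S) (scalars S) (bounded_classes \<phi> S)"
  shows "\<exists>\<Delta>::nat. binomial_bad_class (residue_class S \<phi>) \<longrightarrow>
    (\<forall>\<Psi>. D_good (D_set \<Delta> S) \<Psi> \<longrightarrow>
      (\<exists>f \<in> S \<inter> D_set \<Delta> S. of_nat (\<Psi> f) \<noteq> peval \<phi> f))"
proof (rule ccontr)
  assume contr: "\<not> ?thesis"
  obtain T where T: "T \<subseteq> S" "finite T"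
    and det: "\<And>\<psi> g. residue_class S \<psi> \<in> bounded_classes \<phi> S \<Longrightarrow>
      \<forall>t\<in>T. peval \<psi> t = 0 \<Longrightarrow> g \<in> S \<Longrightarrow> peval \<psi> g = 0"
    using finite_dimension_determining_set[OF assms] by metis
  define B where "B = (\<Union>t\<in>T. {..t})"
  have finB: "finite B"
    using T(2) finite_below by (auto simp: B_def atMost_def)
  have "\<exists>c :: ('k \<Rightarrow> nat) \<Rightarrow> nat. \<forall>f\<in>S. (\<forall>i. f i \<le> \<Delta>) \<longrightarrow>
      peval \<phi> f = (\<Sum>b\<in>{..f}. of_nat (c b) * peval (binomial_poly b) f)" for \<Delta>
  proof -
    obtain \<Psi> where \<Psi>: "D_good (D_set \<Delta> S) \<Psi>"
      "\<And>f. f \<in> S \<inter> D_set \<Delta> S \<Longrightarrow> of_nat (\<Psi> f) = peval \<phi> f"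
      using contr by blast
    have "f \<in> D_set \<Delta> S" if "f \<in> S" "\<forall>i. f i \<le> \<Delta>" for f
      using that by (auto simp: D_set_def down_closure_def)
    with \<Psi> show ?thesis
      by (elim D_good_nat_coefficients) (metis IntI)
  qed
  then obtain C :: "nat \<Rightarrow> ('k \<Rightarrow> nat) \<Rightarrow> nat" where
    C: "\<And>\<Delta> f. f \<in> S \<Longrightarrow> (\<forall>i. f i \<le> \<Delta>) \<Longrightarrow>
      peval \<phi> f = (\<Sum>b\<in>{..f}. of_nat (C \<Delta> b) * peval (binomial_poly b) f)"
    by metis
  obtain M where M: "\<And>t. t \<in> T \<Longrightarrow> peval \<phi> t < of_nat M"
  proof -
    obtain r where r: "\<forall>t\<in>T. peval \<phi> t \<le> r"
      using bdd_above_finite[of "peval \<phi> ` T"] T(2) by (auto simp: bdd_above_def)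
    obtain M where "r < of_nat M" using reals_Archimedean2 by blast
    with r show ?thesis by (meson that le_less_trans)
  qed
  \<comment> \<open>From size \<open>\<Delta>0\<close> on, the boxes contain \<open>T\<close>, so
    the expansions are valid at every point of \<open>T\<close>.\<close>
  obtain \<Delta>0 where \<Delta>0: "\<And>t i. t \<in> T \<Longrightarrow> t i \<le> \<Delta>0"
  proof
    fix t i assume "t \<in> T"
    then show "t i \<le> (\<Sum>t\<in>T. \<Sum>i\<in>UNIV. t i)"
      using T(2) member_le_sum[of i UNIV t] member_le_sum[of t T "\<lambda>t. \<Sum>i\<in>UNIV. t i"]
      by (auto intro: order_trans)
  qed
  \<comment> \<open>Choose \<open>t\<close> in \<open>T\<close> above \<open>b\<close>. All terms at
    \<open>t\<close> are nonnegative, so the one with index \<open>b\<close> is at most the value of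
    \<phi> at \<open>t\<close>.\<close>
  have C_less: "C \<Delta> b < M" if b: "b \<in> B" and \<Delta>: "\<Delta>0 \<le> \<Delta>" for b \<Delta>
  proof -
    obtain t where t: "t \<in> T" "b \<le> t" using b by (auto simp: B_def)
    have "of_nat (C \<Delta> b) \<le> of_nat (C \<Delta> b) * peval (binomial_poly b) t"
      using peval_binomial_poly_ge_1[OF t(2)] by (simp add: mult_le_cancel_left1)
    also have "\<dots> \<le> (\<Sum>b\<in>{..t}. of_nat (C \<Delta> b) * peval (binomial_poly b) t)"
      using t(2) finite_below[of t]
      by (intro member_le_sum) (auto simp: peval_binomial_poly_nonneg atMost_def)
    also have "\<dots> = peval \<phi> t"
      using t(1) T(1) \<Delta>0 \<Delta> by (intro C[symmetric]) (auto intro: order_trans)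
    also have "\<dots> < of_nat M" by (rule M[OF t(1)])
    finally show ?thesis by simp
  qed
  \<comment> \<open>Restricting to \<open>B\<close> leaves only finitely many coefficient functions;
    by the pigeonhole principle one of them recurs for infinitely many \<Delta>.\<close>
  have "finite ((\<lambda>\<Delta>. restrict (C \<Delta>) B) ` {\<Delta>0..})"
  proof (rule finite_subset)
    show "(\<lambda>\<Delta>. restrict (C \<Delta>) B) ` {\<Delta>0..} \<subseteq> Pi\<^sub>E B (\<lambda>_. {..<M})"
      using C_less by auto
    show "finite (Pi\<^sub>E B (\<lambda>_. {..<M}))"
      using finB by (simp add: finite_PiE)
  qed
  then obtain \<Delta>1 where "infinite {\<Delta> \<in> {\<Delta>0..}. restrict (C \<Delta>) B = restrict (C \<Delta>1) B}"
    using pigeonhole_infinite[OF infinite_Ici] by blast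
  then have frequently: "\<exists>\<Delta>\<ge>m. \<forall>b\<in>B. C \<Delta> b = C \<Delta>1 b" for m
    unfolding infinite_nat_iff_unbounded_le
    by (metis (mono_tags, lifting) mem_Collect_eq restrict_apply')
  define c where "c b = (if b \<in> B then C \<Delta>1 b else 0)" for b
  define p :: "'k qpoly"
    where "p = (\<Sum>b | (of_nat (c b) :: rat) \<noteq> 0. Const (of_nat (c b)) * binomial_poly b)"
  have sub: "{b. (of_nat (c b) :: rat) \<noteq> 0} \<subseteq> B"
    by (auto simp: c_def)
  have "binomial_good p"
    unfolding binomial_good_def p_def
    using finite_subset[OF sub finB] by (intro exI[of _ "\<lambda>b. of_nat (c b)"]) auto
  have p_eq: "peval p f = (\<Sum>b\<in>B. of_nat (C \<Delta>1 b) * peval (binomial_poly b) f)" for f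
    unfolding p_def peval_sum peval_mult peval_Const
    using sub finB by (intro sum.mono_neutral_cong_left) (auto simp: c_def)
  \<comment> \<open>Here \<Delta> may depend on \<open>f\<close>: among the recurring sizes one is
    large enough for its box to contain \<open>f\<close>.\<close>
  have \<phi>_eq: "\<exists>\<Delta>. (\<forall>b\<in>B. C \<Delta> b = C \<Delta>1 b) \<and>
      peval \<phi> f = (\<Sum>b\<in>{..f}. of_nat (C \<Delta> b) * peval (binomial_poly b) f)" if "f \<in> S" for f
  proof -
    obtain \<Delta> where \<Delta>: "\<Delta> \<ge> (\<Sum>i\<in>UNIV. f i)" "\<forall>b\<in>B. C \<Delta> b = C \<Delta>1 b"
      using frequently by blast
    have "\<forall>i. f i \<le> \<Delta>"
      using \<Delta>(1) member_le_sum[of _ UNIV f] by (auto intro: order_trans)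
    then show ?thesis using C[OF that] \<Delta>(2) by blast
  qed
  have p_nonneg: "0 \<le> peval p f" for f
    unfolding p_eq by (intro sum_nonneg) (simp add: peval_binomial_poly_nonneg)
  have p_le: "peval p f \<le> peval \<phi> f" if f: "f \<in> S" for f
  proof -
    obtain \<Delta> where \<Delta>: "\<forall>b\<in>B. C \<Delta> b = C \<Delta>1 b"
      "peval \<phi> f = (\<Sum>b\<in>{..f}. of_nat (C \<Delta> b) * peval (binomial_poly b) f)"
      using \<phi>_eq[OF f] by blast
    \<comment> \<open>Terms of \<open>p\<close> with an index not below \<open>f\<close> vanish at
      \<open>f\<close>.\<close>
    have "peval p f = (\<Sum>b\<in>B \<inter> {..f}. of_nat (C \<Delta> b) * peval (binomial_poly b) f)"
      unfolding p_eq using finB \<Delta>(1)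
      by (intro sum.mono_neutral_cong_right) (auto simp: binomial_poly_eq_0)
    also have "\<dots> \<le> peval \<phi> f"
      unfolding \<Delta>(2) using finite_below[of f]
      by (intro sum_mono2) (auto simp: atMost_def peval_binomial_poly_nonneg)
    finally show ?thesis .
  qed
  have p_eq_T: "peval p t = peval \<phi> t" if t: "t \<in> T" for t
  proof -
    \<comment> \<open>By the choice of \<open>B\<close>, every index that contributes at
      \<open>t\<close> is present in \<open>p\<close>.\<close>
    have "t \<in> S" "{..t} \<subseteq> B" using t T(1) by (auto simp: B_def)
    obtain \<Delta> where \<Delta>: "\<forall>b\<in>B. C \<Delta> b = C \<Delta>1 b"
      "peval \<phi> t = (\<Sum>b\<in>{..t}. of_nat (C \<Delta> b) * peval (binomial_poly b) t)"
      using \<phi>_eq[OF \<open>t \<in> S\<close>] by blast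
    show ?thesis
      unfolding p_eq \<Delta>(2) using finB \<Delta>(1) \<open>{..t} \<subseteq> B\<close>
      by (intro sum.mono_neutral_cong_right) (auto simp: binomial_poly_eq_0)
  qed
  \<comment> \<open>The factor 1 is the witness for \<alpha> in
    \<open>bounded_classes\<close>.\<close>
  have "\<forall>g\<in>S. \<bar>peval (\<phi> - p) g\<bar> \<le> 1 * \<bar>peval \<phi> g\<bar>"
  proof
    fix g assume "g \<in> S"
    then show "\<bar>peval (\<phi> - p) g\<bar> \<le> 1 * \<bar>peval \<phi> g\<bar>"
      using p_nonneg[of g] p_le[of g] by (simp add: peval_diff)
  qed
  then have "residue_class S (\<phi> - p) \<in> bounded_classes \<phi> S"
    unfolding bounded_classes_def by blast
  then have "peval (\<phi> - p) g = 0" if "g \<in> S" for g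
    using that p_eq_T by (intro det) (auto simp: peval_diff)
  then have "p \<in> residue_class S \<phi>"
    by (auto simp: residue_class_altdef peval_diff)
  with \<open>binomial_good p\<close> have "binomial_good_class (residue_class S \<phi>)"
    by (auto simp: binomial_good_class_def)
  then show False using contr by blast
qed

end
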